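(* Let $F\colon\mathbb{R}^n\rightrightarrows\mathbb{R}^p$ and $G\colon\mathbb{R}^p\rightrightarrows\mathbb{R}^q$ be set-valued mappings with convex graphs for which there exists $(x,y,z)\in\mathbb{R}^n\times\mathbb{R}^p\times\mathbb{R}^q$ satisfying $$(x,y)\in\mathrm{ri}(\mathrm{gph}(F))\quad\text{and}\quad(y,z)\in\mathrm{ri}(\mathrm{gph}(G)).$$ Then for any $(\bar{x},\bar{z})\in\mathrm{gph}(G\circ F)$ and $w\in\mathbb{R}^q$ we have $$D^*(G\circ F)(\bar{x},\bar{z})(w)=\bigcap_{\bar{y}\in M(\bar{x},\bar{z})}D^*F(\bar{x},\bar{y})\circ D^*G(\bar{y},\bar{z})(w),$$ where $M(\bar{x},\bar{z}):=F(\bar{x})\cap G^{-1}(\bar{z})$.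
   Context: A set-valued mapping $F\colon\mathbb{R}^n\rightrightarrows\mathbb{R}^p$ assigns to each $x$ a set $F(x)\subset\mathbb{R}^p$ (possibly empty); $\mathrm{gph}(F):=\{(x,y) : y\in F(x)\}$. The composition of set-valued mappings is $(G\circ F)(x):=\bigcup_{y\in F(x)}G(y)$; the same convention applies to the composition of coderivatives, i.e. $D^*F(\bar{x},\bar{y})\circ D^*G(\bar{y},\bar{z})(w)=\bigcup_{v\in D^*G(\bar{y},\bar{z})(w)}D^*F(\bar{x},\bar{y})(v)$. $G^{-1}(\bar{z}):=\{y : \bar{z}\in G(y)\}$. For a convex set $\Omega$ and $\bar{x}\in\Omega$, the normal cone is $N(\bar{x};\Omega):=\{v : \langle v,x-\bar{x}\rangle\le 0\text{ for all }x\in\Omega\}$. The coderivative of $F$ at $(\bar{x},\bar{y})\in\mathrm{gph}(F)$ is $D^*F(\bar{x},\bar{y})(v):=\{u\in\mathbb{R}^n : (u,-v)\in N((\bar{x},\bar{y});\mathrm{gph}(F))\}$, $v\in\mathbb{R}^p$. The relative interior $\mathrm{ri}(\Omega)$ of a convex set $\Omega$ is the set of $x\in\Omega$ for which there is $\gamma>0$ with $\mathbb{B}(x;\gamma)\cap\mathrm{aff}(\Omega)\subset\Omega$ (closed ball, affine hull). *)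

theory Defs
  imports "HOL-Analysis.Analysis"
begin

text \<open>A set-valued mapping from \<open>'a\<close> to \<open>'b\<close> is a function \<open>'a \<Rightarrow> 'b set\<close>; values may be empty.\<close>

definition gph :: "('a \<Rightarrow> 'b set) \<Rightarrow> ('a \<times> 'b) set"
  where "gph F = {(x, y). y \<in> F x}"

definition sv_comp :: "('b \<Rightarrow> 'c set) \<Rightarrow> ('a \<Rightarrow> 'b set) \<Rightarrow> 'a \<Rightarrow> 'c set"  (infixl "\<circ>\<^sub>s" 55)
  where "(G \<circ>\<^sub>s F) x = (\<Union>y \<in> F x. G y)"

definition sv_inv :: "('a \<Rightarrow> 'b set) \<Rightarrow> 'b \<Rightarrow> 'a set"
  where "sv_inv G z = {y. z \<in> G y}"

text \<open>Meaningful for convex \<open>\<Omega>\<close> and \<open>x0 \<in> \<Omega>\<close>; no convention is made outside this case.\<close>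

definition normal_cone :: "'a::real_inner \<Rightarrow> 'a set \<Rightarrow> 'a set"
  where "normal_cone x0 \<Omega> = {v. \<forall>x \<in> \<Omega>. v \<bullet> (x - x0) \<le> 0}"

text \<open>The inner product on the product type is
  \<open>(u, v) \<bullet> (x, y) = u \<bullet> x + v \<bullet> y\<close>, i.e. that of the product Euclidean space.\<close>

definition coderivative ::
    "('a::real_inner \<Rightarrow> 'b::real_inner set) \<Rightarrow> 'a \<Rightarrow> 'b \<Rightarrow> 'b \<Rightarrow> 'a set"
  where "coderivative F x0 y0 v = {u. (u, - v) \<in> normal_cone (x0, y0) (gph F)}"

end

theory Submission
  imports Defs
begin

text \<open>
  Fix a point \<open>yb\<close> of \<open>F xb \<inter> sv_inv G zb\<close>. That \<open>u\<close> lies in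
  \<open>coderivative (G \<circ>\<^sub>s F) xb zb w\<close> says exactly that the linear function \<open>u \<bullet> x - w \<bullet> z\<close>,
  considered on the convex set \<open>gph F \<times> gph G\<close> of all \<open>((x, y), (y', z))\<close>, is maximal at
  \<open>((xb, yb), (yb, zb))\<close> subject to the linear constraint \<open>y - y' = 0\<close>. The hypothesis on relative
  interiors is Slater's condition for this problem: the constraint holds at some relative interior
  point of \<open>gph F \<times> gph G\<close>. Hence there is a Lagrange multiplier \<open>v\<close>
  (\<open>Lagrange_multiplier_linear_constraint\<close>): for all \<open>(x, y) \<in> gph F\<close> and \<open>(y', z) \<in> gph G\<close>,
  \<open>u \<bullet> (x - xb) - w \<bullet> (z - zb) \<le> v \<bullet> (y - y')\<close>. As \<open>(x, y)\<close> and \<open>(y', z)\<close> vary independently,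
  this inequality splits, giving \<open>u \<in> coderivative F xb yb v\<close> and \<open>v \<in> coderivative G yb zb w\<close>.
  The multiplier may depend on \<open>yb\<close>, but one exists for every \<open>yb\<close>, which is what the intersection
  asks for.

  Conversely, adding the normal cone inequalities for \<open>F\<close> and \<open>G\<close> at \<open>y = y'\<close> cancels \<open>v\<close>. A single
  \<open>yb\<close> is enough for this inclusion, and one exists because \<open>(xb, zb) \<in> gph (G \<circ>\<^sub>s F)\<close>.
\<close>

text \<open>
  The multiplier is the slope of a hyperplane supporting the convex set of all \<open>(h x, \<phi> x - t)\<close>
  with \<open>x \<in> C\<close> and \<open>t \<ge> 0\<close> at the point \<open>(h x0, \<phi> x0) = (0, \<phi> x0)\<close>. This point is not in the relative
  interior: relative interior points come from \<open>t > 0\<close>, so their last coordinate over \<open>0\<close> is strictly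
  below the maximum \<open>\<phi> x0\<close>. The relative interior point \<open>x1\<close> with \<open>h x1 = 0\<close> rules out a vertical
  hyperplane, which would yield no slope.
\<close>

lemma Lagrange_multiplier_linear_constraint:
  fixes C :: "'a::euclidean_space set" and h :: "'a \<Rightarrow> 'b::euclidean_space" and \<phi> :: "'a \<Rightarrow> real"
  assumes C: "convex C" and h: "linear h" and \<phi>: "linear \<phi>"
    and x0: "x0 \<in> C" "h x0 = 0"
    and max: "\<And>x. x \<in> C \<Longrightarrow> h x = 0 \<Longrightarrow> \<phi> x \<le> \<phi> x0"
    and x1: "x1 \<in> rel_interior C" "h x1 = 0"
  obtains v where "\<And>x. x \<in> C \<Longrightarrow> \<phi> x - \<phi> x0 \<le> v \<bullet> h x"
proof -
  define f where "f = (\<lambda>p::'a \<times> real. (h (fst p), \<phi> (fst p) - snd p))"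
  define H where "H = f ` (C \<times> {0..})"
  have f: "linear f"
    unfolding f_def
    by (intro linearI) (auto simp: linear_add[OF h] linear_add[OF \<phi>] linear_scale[OF h]
        linear_scale[OF \<phi>] algebra_simps)
  have conv: "convex (C \<times> {0::real..})"
    using C by (simp add: convex_Times)
  have "convex H"
    unfolding H_def using f conv by (rule convex_linear_image)
  have riH: "rel_interior H = f ` (rel_interior C \<times> {0<..})"
    using rel_interior_convex_linear_image[OF f conv] C
    by (simp add: H_def rel_interior_Times)
  have "f (x0, 0) \<in> H"
    using x0 by (simp add: H_def)
  moreover have "f (x0, 0) \<notin> rel_interior H"
  proof
    assume "f (x0, 0) \<in> rel_interior H"
    then obtain x t where "x \<in> rel_interior C" "t > 0" "f (x0, 0) = f (x, t)"
      unfolding riH by auto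
    then show False
      using max[of x] rel_interior_subset[of C] x0 by (auto simp: f_def)
  qed
  ultimately obtain a where le: "\<And>y. y \<in> H \<Longrightarrow> a \<bullet> f (x0, 0) \<le> a \<bullet> y"
    and less: "\<And>y. y \<in> rel_interior H \<Longrightarrow> a \<bullet> f (x0, 0) < a \<bullet> y"
    using supporting_hyperplane_rel_boundary[OF \<open>convex H\<close>] by blast
  obtain p r where a: "a = (p, r)" by (cases a)
  have le': "r * \<phi> x0 \<le> p \<bullet> h x + r * \<phi> x" if "x \<in> C" for x
  proof -
    have "f (x, 0) \<in> H"
      using that by (simp add: H_def)
    then show ?thesis
      using le[of "f (x, 0)"] x0 by (simp add: f_def a)
  qed
  have "f (x1, 1) \<in> rel_interior H"
    using x1 by (auto simp: riH)
  then have "r * \<phi> x0 < r * (\<phi> x1 - 1)"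
    using less[of "f (x1, 1)"] x0 x1 by (auto simp: f_def a)
  moreover have "\<phi> x1 - 1 < \<phi> x0"
    using max[of x1] x1 rel_interior_subset[of C] by auto
  ultimately have r: "r < 0"
    by (meson linorder_not_less mult_left_mono less_imp_le)
  show thesis
  proof
    fix x assume "x \<in> C"
    then have "- r * (\<phi> x - \<phi> x0) \<le> p \<bullet> h x"
      using le' by (simp add: algebra_simps)
    then show "\<phi> x - \<phi> x0 \<le> (p /\<^sub>R (- r)) \<bullet> h x"
      using r by (simp add: field_simps)
  qed
qed

lemma mem_coderivative_iff:
  "u \<in> coderivative F x0 y0 v \<longleftrightarrow> (\<forall>x y. y \<in> F x \<longrightarrow> u \<bullet> (x - x0) \<le> v \<bullet> (y - y0))"
  by (auto simp: coderivative_def normal_cone_def gph_def)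

lemma coderivative_comp_superset:
  assumes "u \<in> coderivative F x0 y0 v" and "v \<in> coderivative G y0 z0 w"
  shows "u \<in> coderivative (G \<circ>\<^sub>s F) x0 z0 w"
  using assms unfolding mem_coderivative_iff sv_comp_def by (blast intro: order_trans)

lemma coderivative_comp_subset:
  fixes F :: "'a::euclidean_space \<Rightarrow> 'b::euclidean_space set"
    and G :: "'b \<Rightarrow> 'c::euclidean_space set"
  assumes F: "convex (gph F)" and G: "convex (gph G)"
    and ri: "(x1, y1) \<in> rel_interior (gph F)" "(y1, z1) \<in> rel_interior (gph G)"
    and y0: "y0 \<in> F x0" "z0 \<in> G y0"
    and u: "u \<in> coderivative (G \<circ>\<^sub>s F) x0 z0 w"
  obtains v where "u \<in> coderivative F x0 y0 v" and "v \<in> coderivative G y0 z0 w"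
proof -
  define h where "h = (\<lambda>c::('a \<times> 'b) \<times> ('b \<times> 'c). snd (fst c) - fst (snd c))"
  define \<phi> where "\<phi> = (\<lambda>c::('a \<times> 'b) \<times> ('b \<times> 'c). u \<bullet> fst (fst c) - w \<bullet> snd (snd c))"
  have C: "convex (gph F \<times> gph G)"
    using F G by (rule convex_Times)
  have h: "linear h"
    unfolding h_def by (intro linearI) (auto simp: algebra_simps)
  have \<phi>: "linear \<phi>"
    unfolding \<phi>_def by (intro linearI) (auto simp: algebra_simps inner_add_right)
  have c0: "((x0, y0), (y0, z0)) \<in> gph F \<times> gph G" "h ((x0, y0), (y0, z0)) = 0"
    using y0 by (auto simp: gph_def h_def)
  have c1: "((x1, y1), (y1, z1)) \<in> rel_interior (gph F \<times> gph G)" "h ((x1, y1), (y1, z1)) = 0"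
    using ri by (auto simp: rel_interior_Times F G h_def)
  have max: "\<phi> c \<le> \<phi> ((x0, y0), (y0, z0))" if "c \<in> gph F \<times> gph G" "h c = 0" for c
  proof -
    obtain x y y' z where "c = ((x, y), (y', z))"
      by (metis surj_pair)
    with that have "c = ((x, y), (y, z))" "y \<in> F x" "z \<in> G y"
      by (auto simp: gph_def h_def)
    moreover from this have "u \<bullet> (x - x0) \<le> w \<bullet> (z - z0)"
      using u by (auto simp: mem_coderivative_iff sv_comp_def)
    ultimately show ?thesis
      by (simp add: \<phi>_def inner_diff_right)
  qed
  obtain v where v: "\<And>c. c \<in> gph F \<times> gph G \<Longrightarrow> \<phi> c - \<phi> ((x0, y0), (y0, z0)) \<le> v \<bullet> h c"
    using Lagrange_multiplier_linear_constraint[OF C h \<phi> c0 max c1] by blast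
  have v': "u \<bullet> (x - x0) - w \<bullet> (z - z0) \<le> v \<bullet> (y - y')" if "y \<in> F x" "z \<in> G y'" for x y y' z
    using v[of "((x, y), (y', z))"] that
    by (simp add: gph_def h_def \<phi>_def inner_diff_right)
  show thesis
  proof
    show "u \<in> coderivative F x0 y0 v"
      using v'[OF _ y0(2)] by (simp add: mem_coderivative_iff)
    show "v \<in> coderivative G y0 z0 w"
      using v'[OF y0(1)] by (simp add: mem_coderivative_iff inner_diff_right algebra_simps)
  qed
qed

theorem theorem11p2:
  fixes F :: "real ^ 'n \<Rightarrow> (real ^ 'p) set"
    and G :: "real ^ 'p \<Rightarrow> (real ^ 'q) set"
  assumes "convex (gph F)" and "convex (gph G)"
    and "\<exists>x y z. (x, y) \<in> rel_interior (gph F) \<and> (y, z) \<in> rel_interior (gph G)"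
  shows "\<forall>xb zb w. (xb, zb) \<in> gph (G \<circ>\<^sub>s F) \<longrightarrow>
    coderivative (G \<circ>\<^sub>s F) xb zb w =
      (\<Inter>yb \<in> F xb \<inter> sv_inv G zb. (coderivative F xb yb \<circ>\<^sub>s coderivative G yb zb) w)"
proof (intro allI impI set_eqI iffI)
  fix xb zb w u
  assume u: "u \<in> coderivative (G \<circ>\<^sub>s F) xb zb w"
  obtain x y z where ri: "(x, y) \<in> rel_interior (gph F)" "(y, z) \<in> rel_interior (gph G)"
    using assms(3) by blast
  show "u \<in> (\<Inter>yb \<in> F xb \<inter> sv_inv G zb. (coderivative F xb yb \<circ>\<^sub>s coderivative G yb zb) w)"
  proof (rule INT_I)
    fix yb assume "yb \<in> F xb \<inter> sv_inv G zb"
    then have "yb \<in> F xb" "zb \<in> G yb"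
      by (auto simp: sv_inv_def)
    then obtain v where "u \<in> coderivative F xb yb v" "v \<in> coderivative G yb zb w"
      using coderivative_comp_subset[OF assms(1,2) ri _ _ u] by blast
    then show "u \<in> (coderivative F xb yb \<circ>\<^sub>s coderivative G yb zb) w"
      by (auto simp: sv_comp_def)
  qed
next
  fix xb zb w u
  assume "(xb, zb) \<in> gph (G \<circ>\<^sub>s F)"
    and u: "u \<in> (\<Inter>yb \<in> F xb \<inter> sv_inv G zb. (coderivative F xb yb \<circ>\<^sub>s coderivative G yb zb) w)"
  then obtain yb where "yb \<in> F xb \<inter> sv_inv G zb"
    by (auto simp: gph_def sv_comp_def sv_inv_def)
  with u have "u \<in> (coderivative F xb yb \<circ>\<^sub>s coderivative G yb zb) w"
    by blast
  then obtain v where "u \<in> coderivative F xb yb v" "v \<in> coderivative G yb zb w"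
    unfolding sv_comp_def by blast
  then show "u \<in> coderivative (G \<circ>\<^sub>s F) xb zb w"
    by (rule coderivative_comp_superset)
qed

end
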